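(* Let $q$ be a prime power and $n,m,k$ integers with $1<k<n$ and $5\le n\le m$. Let $\mathcal C$ be a nondegenerate $L_{\mathrm{rk}}$-optimal $[n,k,d]_{q^m/q}$ code. Then the dual code $\mathcal C^\perp$ is either degenerate or not $L_{\mathrm{rk}}$-optimal.
   Context: $\mathbb{F}_{q^m}$ is the degree-$m$ extension of $\mathbb{F}_q$. Rank weight of $\mathbf v=(v_1,\dots,v_n)\in\mathbb{F}_{q^m}^n$: $\mathrm{w}(\mathbf v)=\dim_{\mathbb{F}_q}\langle v_1,\dots,v_n\rangle_{\mathbb{F}_q}$. An $[n,k,d]_{q^m/q}$ code is a $k$-dimensional $\mathbb{F}_{q^m}$-subspace $\mathcal C\subseteq\mathbb{F}_{q^m}^n$ with minimum nonzero rank weight $d$; nondegenerate means the $\mathbb{F}_q$-span of the columns of a generator matrix has $\mathbb{F}_q$-dimension $n$. The dual code is $\mathcal C^\perp=\{\mathbf d\in\mathbb{F}_{q^m}^n:\sum_i c_id_i=0\ \forall\,\mathbf c\in\mathcal C\}$, an $[n,n-k]_{q^m/q}$ code. $\mathrm{WS}(\mathcal C)=\{\mathrm{w}(\mathbf c):\mathbf c\in\mathcal C\setminus\{\mathbf 0\}\}$; $L_{\mathrm{rk}}(n,m,k',q)$ is the maximum of $|\mathrm{WS}|$ over nondegenerate $[n,k']_{q^m/q}$ codes, and a nondegenerate $[n,k']_{q^m/q}$ code is $L_{\mathrm{rk}}$-optimal if its weight spectrum has size $L_{\mathrm{rk}}(n,m,k',q)$. *)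

theory Defs
  imports
    "HOL-Analysis.Analysis"
    "HOL-Library.Function_Algebras"
    "HOL-Number_Theory.Prime_Powers"
begin

text \<open>
  The field \<open>F_q\<close> is a finite field type \<open>'q\<close>, its degree-\<open>m\<close> extension is a finite
  field type \<open>'a\<close>, and \<open>\<iota> :: 'q \<Rightarrow> 'a\<close> is the inclusion. The ambient space of the
  codes is \<open>'a ^ 'n\<close>, so the length is \<open>CARD('n)\<close>.
\<close>

definition field_embedding :: "('q::field \<Rightarrow> 'a::field) \<Rightarrow> bool" where
  "field_embedding \<iota> \<longleftrightarrow>
     \<iota> 1 = 1 \<and> (\<forall>x y. \<iota> (x + y) = \<iota> x + \<iota> y) \<and> (\<forall>x y. \<iota> (x * y) = \<iota> x * \<iota> y)"

definition base_scale :: "('q::field \<Rightarrow> 'a::field) \<Rightarrow> 'q \<Rightarrow> 'a \<Rightarrow> 'a" where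
  "base_scale \<iota> c x = \<iota> c * x"

definition base_scale_fun :: "('q::field \<Rightarrow> 'a::field) \<Rightarrow> 'q \<Rightarrow> (nat \<Rightarrow> 'a) \<Rightarrow> (nat \<Rightarrow> 'a)" where
  "base_scale_fun \<iota> c f = (\<lambda>i. \<iota> c * f i)"

lemma vector_space_base_scale: "field_embedding \<iota> \<Longrightarrow> vector_space (base_scale \<iota>)"
  by unfold_locales (simp_all add: field_embedding_def base_scale_def algebra_simps)

lemma vector_space_base_scale_fun: "field_embedding \<iota> \<Longrightarrow> vector_space (base_scale_fun \<iota>)"
  by unfold_locales
     (simp_all add: field_embedding_def base_scale_fun_def fun_eq_iff algebra_simps)

definition extension_degree :: "('q::field \<Rightarrow> 'a::field) \<Rightarrow> nat" where
  "extension_degree \<iota> = vector_space.dim (base_scale \<iota>) (UNIV :: 'a set)"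

definition rank_weight :: "('q::field \<Rightarrow> 'a::field) \<Rightarrow> 'a ^ 'n \<Rightarrow> nat" where
  "rank_weight \<iota> v =
     vector_space.dim (base_scale \<iota>) (module.span (base_scale \<iota>) (range (\<lambda>j. v $ j)))"

definition weight_spectrum :: "('q::field \<Rightarrow> 'a::field) \<Rightarrow> ('a ^ 'n) set \<Rightarrow> nat set" where
  "weight_spectrum \<iota> C = rank_weight \<iota> ` (C - {0})"

definition is_code :: "nat \<Rightarrow> ('a::field ^ 'n) set \<Rightarrow> bool" where
  "is_code k C \<longleftrightarrow> vec.subspace C \<and> vec.dim C = k"

definition is_code_min_dist ::
    "('q::field \<Rightarrow> 'a::field) \<Rightarrow> nat \<Rightarrow> nat \<Rightarrow> ('a ^ 'n) set \<Rightarrow> bool" where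
  "is_code_min_dist \<iota> k d C \<longleftrightarrow> is_code k C \<and> d = Min (weight_spectrum \<iota> C)"

text \<open>
  The dimension of a code is not fixed by a type, so a \<open>k \<times> n\<close> generator matrix is given
  by its rows \<open>G 0, \<dots>, G (k - 1)\<close>, and its columns, elements of the \<open>k\<close>-fold power of
  \<open>'a\<close>, are represented by functions on \<open>nat\<close> vanishing outside \<open>{..<k}\<close>.
\<close>

definition generator_matrix :: "nat \<Rightarrow> (nat \<Rightarrow> 'a::field ^ 'n) \<Rightarrow> ('a ^ 'n) set \<Rightarrow> bool" where
  "generator_matrix k G C \<longleftrightarrow>
     inj_on G {..<k} \<and> vec.independent (G ` {..<k}) \<and> vec.span (G ` {..<k}) = C"

definition matrix_column :: "nat \<Rightarrow> (nat \<Rightarrow> 'a::field ^ 'n) \<Rightarrow> 'n \<Rightarrow> nat \<Rightarrow> 'a" where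
  "matrix_column k G j = (\<lambda>i. if i < k then G i $ j else 0)"

text \<open>
  Another generator matrix of the same code arises by an invertible row transformation,
  which preserves the dimension below, so the choice of \<open>G\<close> is immaterial.
\<close>

definition nondegenerate :: "('q::field \<Rightarrow> 'a::field) \<Rightarrow> ('a ^ 'n) set \<Rightarrow> bool" where
  "nondegenerate \<iota> C \<longleftrightarrow>
     (\<exists>k G. generator_matrix k G C \<and>
        vector_space.dim (base_scale_fun \<iota>)
          (module.span (base_scale_fun \<iota>) (range (matrix_column k G))) = CARD('n))"

definition dual_code :: "('a::field ^ 'n) set \<Rightarrow> ('a ^ 'n) set" where
  "dual_code C = {x. \<forall>c\<in>C. (\<Sum>j\<in>UNIV. c $ j * x $ j) = 0}"

text \<open>
  By uniqueness of finite fields this depends only on \<open>CARD('n)\<close>, \<open>extension_degree \<iota>\<close>,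
  \<open>k\<close> and \<open>CARD('q)\<close>. It is only meaningful if a nondegenerate code of dimension \<open>k\<close> exists.
\<close>

definition L_rk :: "('q::field \<Rightarrow> 'a::field) \<Rightarrow> 'n::finite itself \<Rightarrow> nat \<Rightarrow> nat" where
  "L_rk \<iota> _ k =
     Max {card (weight_spectrum \<iota> C) | C :: ('a ^ 'n) set. is_code k C \<and> nondegenerate \<iota> C}"

definition L_rk_optimal :: "('q::field \<Rightarrow> 'a::field) \<Rightarrow> ('a ^ 'n) set \<Rightarrow> bool" where
  "L_rk_optimal \<iota> C \<longleftrightarrow>
     vec.subspace C \<and> nondegenerate \<iota> C \<and>
     card (weight_spectrum \<iota> C) = L_rk \<iota> TYPE('n) (vec.dim C)"

end

theory Submission
  imports Defs
begin

text \<open>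
  If \<open>k \<le> n < 2 ^ k\<close>, then \<open>n\<close> splits into \<open>k\<close> positive parts whose subset sums are all of
  \<open>0, \<dots>, n\<close>. Place elements of the extension field that are independent over the base field
  in \<open>k\<close> disjoint blocks of these lengths, one block per row: the \<open>0/1\<close>-combinations of the
  rows have every weight \<open>1, \<dots>, n\<close>, so an optimal code of dimension \<open>k\<close> contains a word of
  weight one. Such a word is a multiple of a vector over the base field, which is a linear
  relation between the columns of every generator matrix of a code orthogonal to it; that
  code is therefore degenerate. For \<open>n \<ge> 5\<close> one of \<open>C\<close> and its dual has dimension at least
  \<open>n / 2\<close>, hence satisfies \<open>n < 2 ^ k\<close>.
\<close>

section \<open>Linear independence of indexed families\<close>

text \<open>Passes between dimension counts and linear relations. Indexing by \<open>J\<close>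
  matters: two equal columns of a matrix must count as dependent, which the set of columns cannot
  show. It serves for \<open>base_scale\<close>, \<open>base_scale_fun\<close> and
  \<open>vec\<close>.\<close>

lemma (in vector_space) dim_span_image_eq_card_iff:
  assumes "finite J"
  shows "dim (span (g ` J)) = card J \<longleftrightarrow>
    (\<forall>u. (\<Sum>j\<in>J. scale (u j) (g j)) = 0 \<longrightarrow> (\<forall>j\<in>J. u j = 0))"
proof
  assume dim: "dim (span (g ` J)) = card J"
  obtain B where B: "B \<subseteq> g ` J" "independent B" "g ` J \<subseteq> span B" "card B = dim (g ` J)"
    using basis_exists[of "g ` J"] by blast
  have fin: "finite (g ` J)" using assms by simp
  \<comment> \<open>The chain of inequalities closes up, so \<open>g\<close> is injective on
    \<open>J\<close> and its image is the basis \<open>B\<close> itself.\<close>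
  have "card J = card B" using B(4) dim by (simp add: dim_span)
  moreover have "card B \<le> card (g ` J)" by (rule card_mono[OF fin B(1)])
  moreover have "card (g ` J) \<le> card J" by (rule card_image_le[OF assms])
  ultimately have "card (g ` J) = card J" "card B = card (g ` J)" by simp_all
  then have inj: "inj_on g J" and "B = g ` J"
    using eq_card_imp_inj_on[OF assms] card_subset_eq[OF fin B(1)] by auto
  then have indep: "independent (g ` J)" using B(2) by simp
  show "\<forall>u. (\<Sum>j\<in>J. scale (u j) (g j)) = 0 \<longrightarrow> (\<forall>j\<in>J. u j = 0)"
  proof (intro allI impI)
    fix u assume u: "(\<Sum>j\<in>J. scale (u j) (g j)) = 0"
    define v where "v = u \<circ> the_inv_into J g"
    have v: "v (g j) = u j" if "j \<in> J" for j
      using that inj by (simp add: v_def the_inv_into_f_f)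
    have "(\<Sum>x\<in>g ` J. scale (v x) x) = (\<Sum>j\<in>J. scale (v (g j)) (g j))"
      by (simp add: sum.reindex[OF inj])
    also have "\<dots> = 0" using u v by simp
    finally have "\<forall>x\<in>g ` J. v x = 0"
      using indep dependent_finite[OF fin] by blast
    then show "\<forall>j\<in>J. u j = 0" using v by auto
  qed
next
  assume *: "\<forall>u. (\<Sum>j\<in>J. scale (u j) (g j)) = 0 \<longrightarrow> (\<forall>j\<in>J. u j = 0)"
  have inj: "inj_on g J"
  proof (rule inj_onI, rule ccontr)
    fix a b assume ab: "a \<in> J" "b \<in> J" "g a = g b" "a \<noteq> b"
    define u :: "'c \<Rightarrow> 'a" where "u = (\<lambda>j. if j = a then 1 else if j = b then - 1 else 0)"
    have "(\<Sum>j\<in>J. scale (u j) (g j)) =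
        (\<Sum>j\<in>J. (if j = a then g a else 0) + (if j = b then - g b else 0))"
      by (rule sum.cong) (use ab in \<open>auto simp: u_def\<close>)
    also have "\<dots> = 0" using ab assms by (simp add: sum.distrib)
    finally have "u a = 0" using * ab(1) by blast
    then show False by (simp add: u_def)
  qed
  have "independent (g ` J)"
  proof
    assume "dependent (g ` J)"
    then obtain v where v: "\<exists>x\<in>g ` J. v x \<noteq> 0" "(\<Sum>x\<in>g ` J. scale (v x) x) = 0"
      using assms by (auto simp: dependent_finite)
    then have "(\<Sum>j\<in>J. scale (v (g j)) (g j)) = 0" by (simp add: sum.reindex[OF inj])
    with *[rule_format, of "\<lambda>j. v (g j)"] v(1) show False by auto
  qed
  then show "dim (span (g ` J)) = card J"
    using inj by (simp add: dim_span dim_eq_card_independent card_image)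
qed

section \<open>Partitions with all subset sums\<close>

text \<open>The parts are the fibres of \<open>f\<close>, nonempty because \<open>f\<close> hits
  every label. If the earlier parts realise all sums up to \<open>s\<close>, a new part of size at
  most \<open>s + 1\<close> leaves no gap above \<open>s\<close>.\<close>

lemma subset_sums_partition:
  assumes "finite A" and "k \<le> card A" and "card A < 2 ^ k"
  shows "\<exists>f::'b \<Rightarrow> nat. f ` A = {..<k} \<and>
    (\<forall>w\<le>card A. \<exists>I\<subseteq>{..<k}. card {j \<in> A. f j \<in> I} = w)"
  using assms
proof (induction k arbitrary: A)
  case 0
  then show ?case by simp
next
  case (Suc k)
  \<comment> \<open>Halving keeps the new part at size at most \<open>s + 1\<close> and
    \<open>s\<close> below \<open>2 ^ k\<close>; the maximum with \<open>k\<close> leaves enough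
    elements for \<open>k\<close> nonempty parts.\<close>
  define s where "s = max k (card A div 2)"
  have s: "s < card A" "k \<le> s" "s < 2 ^ k" "card A - s \<le> s + 1"
    using Suc.prems by (auto simp: s_def max_def)
  obtain B where B: "B \<subseteq> A" "card B = s"
    using s(1) obtain_subset_with_card_n[of s A] by (metis less_imp_le)
  have finB: "finite B" using B Suc.prems finite_subset by blast
  obtain f where f: "f ` B = {..<k}"
    "\<And>w. w \<le> s \<Longrightarrow> \<exists>I\<subseteq>{..<k}. card {j \<in> B. f j \<in> I} = w"
    using Suc.IH[OF finB] s B by auto
  define h where "h = (\<lambda>j. if j \<in> B then f j else k)"
  have AB: "A - B \<noteq> {}" "card (A - B) = card A - s"
    using s(1) B finB by (auto simp: card_Diff_subset dest: card_mono)
  have "A = B \<union> (A - B)" using B by blast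
  then have "h ` A = h ` B \<union> h ` (A - B)" by (metis image_Un)
  also have "h ` B = {..<k}" using f(1) by (auto simp: h_def)
  also have "h ` (A - B) = {k}" using AB by (auto simp: h_def)
  finally have im: "h ` A = {..<Suc k}" by auto
  have "\<exists>I\<subseteq>{..<Suc k}. card {j \<in> A. h j \<in> I} = w" if w: "w \<le> card A" for w
  proof (cases "w \<le> s")
    case True
    then obtain I where I: "I \<subseteq> {..<k}" "card {j \<in> B. f j \<in> I} = w" using f(2) by blast
    have "{j \<in> A. h j \<in> I} = {j \<in> B. f j \<in> I}" using I(1) B by (auto simp: h_def)
    then show ?thesis using I by (intro exI[of _ I]) auto
  next
    case False
    \<comment> \<open>Sums above \<open>s\<close> include the new part. As \<open>w\<close> is at
      least its size \<open>card A - s\<close>, the truncated subtraction is exact.\<close>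
    then have "w - (card A - s) \<le> s" using w by linarith
    then obtain I where I: "I \<subseteq> {..<k}" "card {j \<in> B. f j \<in> I} = w - (card A - s)"
      using f(2) by blast
    have "{j \<in> A. h j \<in> insert k I} = {j \<in> B. f j \<in> I} \<union> (A - B)"
      using I(1) B f(1) by (auto simp: h_def)
    also have "card \<dots> = w - (card A - s) + (card A - s)"
      using finB Suc.prems(1) I AB by (subst card_Un_disjoint) auto
    also have "\<dots> = w" using False s(4) by simp
    finally show ?thesis using I(1) by (intro exI[of _ "insert k I"]) auto
  qed
  with im show ?case by blast
qed

section \<open>A code with every weight\<close>

lemma sum_fun_apply:
  fixes f :: "'b \<Rightarrow> 'c \<Rightarrow> 'd::comm_monoid_add"
  shows "(\<Sum>j\<in>A. f j) i = (\<Sum>j\<in>A. f j i)"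
  by (induction A rule: infinite_finite_induct) simp_all

text \<open>A basis of the extension over the base field has at least as many elements as there are
  coordinates; this is where the length being at most the degree enters.\<close>

lemma base_independent_family_exists:
  fixes \<iota> :: "'q::field \<Rightarrow> 'a::{field,finite}"
  assumes "field_embedding \<iota>" and "CARD('n::finite) \<le> extension_degree \<iota>"
  obtains \<beta> :: "'n::finite \<Rightarrow> 'a" where "\<And>u. (\<Sum>j\<in>UNIV. \<iota> (u j) * \<beta> j) = 0 \<Longrightarrow> \<forall>j. u j = 0"
proof -
  interpret V: vector_space "base_scale \<iota>" by (rule vector_space_base_scale[OF assms(1)])
  obtain B where B: "V.independent B" "card B = extension_degree \<iota>"
    using V.basis_exists[of UNIV] unfolding extension_degree_def by blast
  obtain B' where B': "B' \<subseteq> B" "card B' = CARD('n)"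
    using obtain_subset_with_card_n[of "CARD('n)" B] assms(2) B(2) by metis
  obtain \<beta> :: "'n \<Rightarrow> 'a" where bij: "bij_betw \<beta> UNIV B'"
    using B'(2) finite_same_card_bij[of "UNIV::'n set" B'] by auto
  have "V.independent B'" using B(1) B'(1) V.independent_mono by blast
  then have "V.dim (V.span (range \<beta>)) = CARD('n)"
    using bij B'(2) by (simp add: bij_betw_def V.dim_span V.dim_eq_card_independent)
  then have *: "\<forall>u. (\<Sum>j\<in>UNIV. \<iota> (u j) * \<beta> j) = 0 \<longrightarrow> (\<forall>j\<in>UNIV. u j = 0)"
    unfolding V.dim_span_image_eq_card_iff[OF finite] base_scale_def .
  show thesis by (intro that[of \<beta>] allI) (rule *[rule_format, OF _ UNIV_I])
qed

text \<open>The rows have disjoint supports, so a sum of rows has as its nonzero entries the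
  \<beta>'s of the chosen blocks, and its weight is the number of positions they cover.\<close>

lemma full_spectrum_code_exists:
  fixes \<iota> :: "'q::field \<Rightarrow> 'a::{field,finite}"
  assumes emb: "field_embedding \<iota>" and deg: "CARD('n::finite) \<le> extension_degree \<iota>"
    and k: "k \<le> CARD('n)" "CARD('n) < 2 ^ k"
  shows "\<exists>D :: ('a ^ 'n::finite) set. is_code k D \<and> nondegenerate \<iota> D \<and>
    {1..CARD('n)} \<subseteq> weight_spectrum \<iota> D"
proof -
  interpret V: vector_space "base_scale \<iota>" by (rule vector_space_base_scale[OF emb])
  interpret F: vector_space "base_scale_fun \<iota>" by (rule vector_space_base_scale_fun[OF emb])
  have \<iota>0: "\<iota> 0 = 0" using V.scale_zero_left[of 1] by (simp add: base_scale_def)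
  obtain \<beta> :: "'n \<Rightarrow> 'a" where \<beta>: "\<And>u. (\<Sum>j\<in>UNIV. \<iota> (u j) * \<beta> j) = 0 \<Longrightarrow> \<forall>j. u j = 0"
    using base_independent_family_exists[OF emb deg] by blast
  \<comment> \<open>Extending the coefficients by zero turns a relation on \<open>J\<close> into one
    on all coordinates.\<close>
  have \<beta>J: "\<forall>j\<in>J. u j = 0" if "(\<Sum>j\<in>J. \<iota> (u j) * \<beta> j) = 0" for J u
  proof -
    define v where "v = (\<lambda>j. if j \<in> J then u j else 0)"
    have "(\<Sum>j\<in>UNIV. \<iota> (v j) * \<beta> j) = (\<Sum>j\<in>J. \<iota> (u j) * \<beta> j)"
      by (rule sum.mono_neutral_cong_right) (auto simp: \<iota>0 v_def)
    with that have "\<forall>j. v j = 0" by (intro \<beta>) (rule trans)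
    then show ?thesis unfolding v_def by metis
  qed
  have \<iota>1: "\<iota> 1 = 1" using emb by (simp add: field_embedding_def)
  have \<beta>0: "\<beta> j \<noteq> 0" for j using \<beta>J[of "\<lambda>_. 1" "{j}"] by auto
  obtain f :: "'n \<Rightarrow> nat" where f: "range f = {..<k}"
    "\<And>w. w \<le> CARD('n) \<Longrightarrow> \<exists>I\<subseteq>{..<k}. card {j. f j \<in> I} = w"
    using subset_sums_partition[of "UNIV::'n set" k] k by auto
  define G :: "nat \<Rightarrow> 'a ^ 'n" where "G = (\<lambda>i. \<chi> j. if f j = i then \<beta> j else 0)"
  define D where "D = vec.span (G ` {..<k})"
  have comb: "(\<Sum>i\<in>I. c i *s G i) $ j = (if f j \<in> I then c (f j) * \<beta> j else 0)"
    if "I \<subseteq> {..<k}" for c I j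
  proof -
    have "finite I" using that finite_subset by blast
    have "(\<Sum>i\<in>I. c i *s G i) $ j = (\<Sum>i\<in>I. if i = f j then c (f j) * \<beta> j else 0)"
      unfolding sum_component by (rule sum.cong) (auto simp: G_def)
    then show ?thesis using \<open>finite I\<close> by simp
  qed
  have "c i = 0" if c: "(\<Sum>i<k. c i *s G i) = 0" and "i < k" for c i
  proof -
    obtain j where j: "f j = i" using f(1) \<open>i < k\<close> by (metis lessThan_iff rangeE)
    have "(\<Sum>i<k. c i *s G i) $ j = c i * \<beta> j" using comb j \<open>i < k\<close> by simp
    then show ?thesis using c \<beta>0 by simp
  qed
  then have "vec.dim (vec.span (G ` {..<k})) = k"
    using vec.dim_span_image_eq_card_iff[of "{..<k}" G] by auto
  then have dimD: "vec.dim D = k" "vec.dim (G ` {..<k}) = k" by (simp_all add: D_def vec.dim_span)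
  \<comment> \<open>At most \<open>k\<close> vectors span dimension \<open>k\<close>, so they are
    distinct and independent.\<close>
  have card: "card (G ` {..<k}) = k"
    using vec.dim_le_card'[of "G ` {..<k}"] dimD(2) card_image_le[of "{..<k}" G] by simp
  have "inj_on G {..<k}" by (rule eq_card_imp_inj_on) (simp_all add: card)
  moreover have "vec.independent (G ` {..<k})"
    by (rule vec.card_le_dim_spanning[of _ D])
      (use card dimD(1) in \<open>simp_all add: D_def vec.span_superset\<close>)
  ultimately have gm: "generator_matrix k G D" by (simp add: generator_matrix_def D_def)
  have "\<forall>j. u j = 0" if u: "(\<Sum>j\<in>UNIV. base_scale_fun \<iota> (u j) (matrix_column k G j)) = 0" for u
  proof -
    \<comment> \<open>Row \<open>i\<close> vanishes outside block \<open>i\<close>, so coordinate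
      \<open>i\<close> of the column relation is a relation among the \<beta>'s of that block alone.
      Labels from \<open>k\<close> on have empty blocks.\<close>
    have "\<forall>j\<in>{j. f j = i}. u j = 0" for i
    proof (cases "i < k")
      case True
      have "0 = (\<Sum>j\<in>UNIV. base_scale_fun \<iota> (u j) (matrix_column k G j)) i" using u by simp
      also have "\<dots> = (\<Sum>j\<in>UNIV. \<iota> (u j) * (if f j = i then \<beta> j else 0))"
        using True by (simp add: sum_fun_apply base_scale_fun_def matrix_column_def G_def)
      also have "\<dots> = (\<Sum>j\<in>{j. f j = i}. \<iota> (u j) * \<beta> j)"
        by (rule sum.mono_neutral_cong_right) auto
      finally show ?thesis by (intro \<beta>J) (rule sym)
    next
      case False
      then show ?thesis using f(1) by auto
    qed
    then show ?thesis by blast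
  qed
  then have "F.dim (F.span (range (matrix_column k G))) = CARD('n)"
    unfolding F.dim_span_image_eq_card_iff[OF finite] by simp
  with gm have "nondegenerate \<iota> D" unfolding nondegenerate_def by blast
  moreover have "w \<in> weight_spectrum \<iota> D" if w: "w \<in> {1..CARD('n)}" for w
  proof -
    obtain I where I: "I \<subseteq> {..<k}" "card {j. f j \<in> I} = w" using f(2) w by auto
    define J where "J = {j. f j \<in> I}"
    define x where "x = (\<Sum>i\<in>I. 1 *s G i)"
    have x: "x $ j = (if j \<in> J then \<beta> j else 0)" for j using comb[OF I(1), of "\<lambda>_. 1"]
      by (simp add: x_def J_def)
    \<comment> \<open>Zero is inserted on both sides because it is an entry of \<open>x\<close> only
      if \<open>J\<close> is not everything; the spans do not change.\<close>
    have "insert 0 (range (($) x)) = insert 0 (\<beta> ` J)" by (auto simp: x image_iff)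
    then have "V.span (range (($) x)) = V.span (\<beta> ` J)" by (metis V.span_insert_0)
    moreover have "V.dim (V.span (\<beta> ` J)) = card J"
      unfolding V.dim_span_image_eq_card_iff[OF finite] base_scale_def
      by (intro allI impI \<beta>J)
    ultimately have "rank_weight \<iota> x = w" using I(2) by (simp add: rank_weight_def J_def)
    moreover have "x \<in> D" unfolding x_def D_def
      using I(1) by (intro vec.span_sum vec.span_scale vec.span_base) auto
    moreover have "J \<noteq> {}" using I(2) w unfolding J_def[symmetric] by auto
    then have "x \<noteq> 0" using x \<beta>0 by (metis all_not_in_conv zero_index)
    ultimately show ?thesis by (auto simp: weight_spectrum_def)
  qed
  moreover have "is_code k D" using dimD by (simp add: is_code_def D_def vec.subspace_span)
  ultimately show ?thesis by blast
qed

section \<open>Words of weight one\<close>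

lemma weight_spectrum_subset:
  fixes \<iota> :: "'q::field \<Rightarrow> 'a::field" and C :: "('a ^ 'n::finite) set"
  assumes "field_embedding \<iota>"
  shows "weight_spectrum \<iota> C \<subseteq> {1..CARD('n)}"
proof
  interpret V: vector_space "base_scale \<iota>" by (rule vector_space_base_scale[OF assms])
  fix w assume "w \<in> weight_spectrum \<iota> C"
  then obtain x :: "'a ^ 'n" where "x \<noteq> 0" "w = rank_weight \<iota> x" by (auto simp: weight_spectrum_def)
  then have x: "x \<noteq> 0" "w = V.dim (range (($) x))" unfolding rank_weight_def V.dim_span by auto
  obtain B where B: "B \<subseteq> range (($) x)" "range (($) x) \<subseteq> V.span B" "card B = w"
    using V.basis_exists[of "range (($) x)"] x(2) by metis
  have "finite B" using B(1) by (rule finite_subset) simp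
  have "B \<noteq> {}" using B(2) x(1) by (force simp: vec_eq_iff)
  then have "1 \<le> w" using B(3) \<open>finite B\<close> by (auto simp: Suc_le_eq)
  moreover have "w \<le> card (range (($) x))" using B(1,3) card_mono by (metis finite finite_imageI)
  then have "w \<le> CARD('n)" using card_image_le[of UNIV "($) x"] by (meson finite le_trans)
  ultimately show "w \<in> {1..CARD('n)}" by simp
qed

text \<open>The code with every weight is a competitor in \<open>L_rk\<close>, so an optimal code
  has at least \<open>CARD('n)\<close> weights. All of them lie in \<open>{1..CARD('n)}\<close>,
  hence each value occurs, in particular 1.\<close>

lemma optimal_code_has_weight_one:
  fixes \<iota> :: "'q::field \<Rightarrow> 'a::{field,finite}" and D :: "('a ^ 'n::finite) set"
  assumes emb: "field_embedding \<iota>" and deg: "CARD('n) \<le> extension_degree \<iota>"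
    and opt: "L_rk_optimal \<iota> D" and n: "CARD('n) < 2 ^ vec.dim D"
  obtains x where "x \<in> D" and "rank_weight \<iota> x = 1"
proof -
  have "vec.dim D \<le> CARD('n)"
    using vec.dim_subset[OF subset_UNIV, of D] by (simp only: vec_dim_card)
  then obtain E :: "('a ^ 'n) set" where E: "is_code (vec.dim D) E" "nondegenerate \<iota> E"
    "{1..CARD('n)} \<subseteq> weight_spectrum \<iota> E"
    using full_spectrum_code_exists[OF emb deg _ n] by blast
  have sub: "weight_spectrum \<iota> D \<subseteq> {1..CARD('n)}" by (rule weight_spectrum_subset[OF emb])
  have "card {1..CARD('n)} = card (weight_spectrum \<iota> E)"
    using E(3) weight_spectrum_subset[OF emb, of E] by (metis subset_antisym)
  also have "\<dots> \<le> L_rk \<iota> TYPE('n) (vec.dim D)"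
    \<comment> \<open>The maximum is over a finite set because the ambient space is finite.\<close>
    unfolding L_rk_def by (rule Max_ge) (use E in \<open>auto intro: finite_image_set\<close>)
  also have "\<dots> = card (weight_spectrum \<iota> D)" using opt by (simp add: L_rk_optimal_def)
  finally have "weight_spectrum \<iota> D = {1..CARD('n)}"
    using sub by (meson card_seteq finite_atLeastAtMost)
  moreover have "(1::nat) \<in> {1..CARD('n)}" by (simp add: Suc_le_eq)
  ultimately show thesis using that by (force simp: weight_spectrum_def)
qed

text \<open>Weight one means that all entries of \<open>x\<close> are base-field multiples of one
  \<open>b\<close>. Dividing orthogonality to the rows by \<open>b\<close> leaves a nontrivial
  base-field relation among the columns.\<close>

lemma weight_one_orthogonal_degenerate:
  fixes \<iota> :: "'q::field \<Rightarrow> 'a::field" and E :: "('a ^ 'n::finite) set"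
  assumes emb: "field_embedding \<iota>" and wt: "rank_weight \<iota> x = 1"
    and orth: "\<And>c. c \<in> E \<Longrightarrow> (\<Sum>j\<in>UNIV. c $ j * x $ j) = 0"
  shows "\<not> nondegenerate \<iota> E"
proof
  interpret V: vector_space "base_scale \<iota>" by (rule vector_space_base_scale[OF emb])
  interpret F: vector_space "base_scale_fun \<iota>" by (rule vector_space_base_scale_fun[OF emb])
  assume "nondegenerate \<iota> E"
  then obtain k G where G: "generator_matrix k G E"
    "F.dim (F.span (range (matrix_column k G))) = CARD('n)"
    unfolding nondegenerate_def by blast
  obtain B where B: "B \<subseteq> range (($) x)" "V.independent B" "range (($) x) \<subseteq> V.span B"
    "card B = V.dim (range (($) x))"
    using V.basis_exists[of "range (($) x)"] by metis
  have "card B = 1" using B(4) wt by (simp add: rank_weight_def V.dim_span)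
  then obtain b where b: "B = {b}" using card_1_singletonE by blast
  have b0: "b \<noteq> 0" using B(2) b V.dependent_zero by blast
  have "\<forall>j. \<exists>a. x $ j = \<iota> a * b"
    using B(3) unfolding b V.span_singleton by (auto simp: base_scale_def)
  then obtain a where a: "\<And>j. x $ j = \<iota> (a j) * b" by metis
  have "(\<Sum>j\<in>UNIV. base_scale_fun \<iota> (a j) (matrix_column k G j)) i = 0" for i
  proof (cases "i < k")
    case True
    then have "G i \<in> E" using G(1) by (auto simp: generator_matrix_def intro: vec.span_base)
    then have "0 = (\<Sum>j\<in>UNIV. G i $ j * x $ j)" using orth by simp
    also have "\<dots> = (\<Sum>j\<in>UNIV. \<iota> (a j) * G i $ j) * b"
      unfolding sum_distrib_right by (simp add: a mult_ac)
    finally show ?thesis using b0 True by (simp add: sum_fun_apply base_scale_fun_def matrix_column_def)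
  qed (simp add: sum_fun_apply base_scale_fun_def matrix_column_def)
  then have "\<forall>j. a j = 0"
    using G(2) F.dim_span_image_eq_card_iff[of UNIV "matrix_column k G"] by (auto simp: fun_eq_iff)
  moreover have "\<iota> 0 = 0" using V.scale_zero_left[of 1] by (simp add: base_scale_def)
  ultimately have "x $ j = 0" for j using a by simp
  \<comment> \<open>The nonzero \<open>b\<close> is itself an entry of \<open>x\<close>.\<close>
  then show False using B(1) b b0 by auto
qed

section \<open>Dimension of the dual\<close>

text \<open>Each further linear condition lowers the dimension by at most one.\<close>

lemma dim_dual_code_ge_card:
  fixes S :: "('a::field ^ 'n::finite) set"
  assumes "finite S"
  shows "CARD('n) \<le> vec.dim (dual_code S) + card S"
  using assms
proof (induction S)
  case empty
  then show ?case by (simp add: dual_code_def card_cart_basis)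
next
  case (insert g S)
  have sub: "vec.subspace (dual_code T)" for T :: "('a ^ 'n) set"
    by (auto simp: vec.subspace_def dual_code_def algebra_simps sum.distrib
        simp flip: sum_distrib_left)
  have "vec.dim (dual_code S) \<le> vec.dim (dual_code (insert g S)) + 1"
  proof (cases "dual_code S \<subseteq> dual_code (insert g S)")
    case True
    then show ?thesis using vec.dim_subset by (metis trans_le_add1)
  next
    case False
    define p where "p x = (\<Sum>j\<in>UNIV. g $ j * x $ j)" for x
    obtain z where z: "z \<in> dual_code S" "p z \<noteq> 0"
      using False by (auto simp: dual_code_def p_def)
    have "dual_code S \<subseteq> vec.span (insert z (dual_code (insert g S)))"
    proof
      fix x assume x: "x \<in> dual_code S"
      \<comment> \<open>Projection along \<open>z\<close> onto the kernel of the new functional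
        \<open>p\<close>: adding the single vector \<open>z\<close> recovers the old dual.\<close>
      define y where "y = x - (p x / p z) *s z"
      have "y \<in> dual_code S" unfolding y_def
        using x z(1) sub by (intro vec.subspace_diff vec.subspace_scale)
      moreover have "p y = p x - (p x / p z) * p z"
        unfolding p_def y_def sum_distrib_left by (simp add: algebra_simps sum_subtractf)
      then have "p y = 0" using z(2) by simp
      ultimately have "y \<in> dual_code (insert g S)" by (auto simp: dual_code_def p_def)
      then show "x \<in> vec.span (insert z (dual_code (insert g S)))"
        unfolding vec.span_insert y_def using vec.span_base by blast
    qed
    then have "vec.dim (dual_code S) \<le> vec.dim (insert z (dual_code (insert g S)))"
      by (metis vec.dim_span vec.dim_subset)
    also have "\<dots> \<le> vec.dim (dual_code (insert g S)) + 1" by (simp add: vec.dim_insert)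
    finally show ?thesis .
  qed
  then show ?case using insert by simp
qed

text \<open>A basis imposes the same conditions as the whole code, since the vectors orthogonal to a
  fixed \<open>x\<close> form a subspace.\<close>

lemma dim_dual_code_ge:
  fixes C :: "('a::field ^ 'n::finite) set"
  shows "CARD('n) \<le> vec.dim (dual_code C) + vec.dim C"
proof -
  obtain B where B: "B \<subseteq> C" "vec.independent B" "C \<subseteq> vec.span B" "card B = vec.dim C"
    using vec.basis_exists[of C] by blast
  have "dual_code B \<subseteq> dual_code C"
  proof
    fix x assume x: "x \<in> dual_code B"
    have "vec.subspace {c. (\<Sum>j\<in>UNIV. c $ j * x $ j) = 0}"
      by (auto simp: vec.subspace_def algebra_simps sum.distrib simp flip: sum_distrib_left)
    moreover have "B \<subseteq> {c. (\<Sum>j\<in>UNIV. c $ j * x $ j) = 0}"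
      using x by (auto simp: dual_code_def)
    ultimately have "vec.span B \<subseteq> {c. (\<Sum>j\<in>UNIV. c $ j * x $ j) = 0}"
      by (simp add: vec.span_minimal)
    then show "x \<in> dual_code C" using B(3) by (auto simp: dual_code_def)
  qed
  then have "vec.dim (dual_code B) \<le> vec.dim (dual_code C)" by (rule vec.dim_subset)
  then show ?thesis
    using dim_dual_code_ge_card[OF vec.finiteI_independent[OF B(2)]] B(4) by simp
qed

section \<open>Size estimate and conclusion\<close>

text \<open>The bound 5 forces \<open>k\<close> to be at least 3, from where
  \<open>2 * k < 2 ^ k\<close> holds; \<open>n = 4\<close> with \<open>k = 2\<close> would give
  equality.\<close>

lemma less_two_power_of_half:
  fixes n k :: nat
  assumes "5 \<le> n" and "n \<le> 2 * k"
  shows "n < 2 ^ k"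
proof -
  have "2 * k < 2 ^ k" if "3 \<le> k" for k :: nat
    using that by (induction k rule: dec_induct) auto
  moreover have "3 \<le> k" using assms by linarith
  ultimately show ?thesis using assms(2) le_less_trans by blast
qed

theorem theoremA4:
  fixes q n m k d :: nat
    and \<iota> :: "'q::{field,finite} \<Rightarrow> 'a::{field,finite}"
    and C :: "('a ^ 'n) set"
  assumes "primepow q" and "CARD('q) = q"
    and "field_embedding \<iota>" and "extension_degree \<iota> = m"
    and "CARD('n) = n"
    and "1 < k" and "k < n" and "5 \<le> n" and "n \<le> m"
    and "is_code_min_dist \<iota> k d C"
    and "nondegenerate \<iota> C"
    and "L_rk_optimal \<iota> C"
  shows "\<not> nondegenerate \<iota> (dual_code C) \<or> \<not> L_rk_optimal \<iota> (dual_code C)"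
proof (rule ccontr)
  assume "\<not> ?thesis"
  then have nd: "nondegenerate \<iota> (dual_code C)" and opt: "L_rk_optimal \<iota> (dual_code C)" by auto
  have deg: "CARD('n) \<le> extension_degree \<iota>" using assms by simp
  have "n \<le> vec.dim (dual_code C) + vec.dim C" using dim_dual_code_ge assms(5) by blast
  then consider "n \<le> 2 * vec.dim C" | "n \<le> 2 * vec.dim (dual_code C)" by linarith
  then show False
  proof cases
    case 1
    then have "CARD('n) < 2 ^ vec.dim C" using less_two_power_of_half assms(5,8) by blast
    then obtain x where "x \<in> C" "rank_weight \<iota> x = 1"
      using optimal_code_has_weight_one[OF assms(3) deg assms(12)] by blast
    \<comment> \<open>Orthogonality is symmetric: a word of \<open>C\<close> annihilates the dual
      just as dual words annihilate \<open>C\<close>.\<close>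
    then show False using weight_one_orthogonal_degenerate[OF assms(3), of x "dual_code C"] nd
      by (simp add: dual_code_def mult.commute)
  next
    case 2
    then have "CARD('n) < 2 ^ vec.dim (dual_code C)"
      using less_two_power_of_half assms(5,8) by blast
    then obtain x where "x \<in> dual_code C" "rank_weight \<iota> x = 1"
      using optimal_code_has_weight_one[OF assms(3) deg opt] by blast
    then show False using weight_one_orthogonal_degenerate[OF assms(3), of x C] assms(11)
      by (simp add: dual_code_def)
  qed
qed

end
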